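(* Let $R$ be a commutative ring with unity that has at least one nontrivial idempotent and such that $\mathrm{Cl}(R)$ is not a complete graph. Then $\mathrm{Cl}(R)_{SR}=G+K_{|U(R)|}$, i.e. $\mathrm{Cl}(R)_{SR}$ is the disjoint union of the graph $G$ and a complete graph on $|U(R)|$ vertices, and $G$ is a connected graph. Moreover, $V(\mathrm{Cl}(R))=V(\mathrm{Cl}(R)_{SR})$.
   Context: All rings are commutative with unity. $U(R)$ is the set of units, $\mathrm{Id}(R)$ the set of idempotents. The clean graph $\mathrm{Cl}(R)$ has vertex set $\{(e,u): e\in\mathrm{Id}(R), u\in U(R)\}$, two distinct vertices $(e,u),(f,v)$ being adjacent iff $ef=0$ or $uv=1$. In a connected graph $\Gamma$ with distance $d$ and neighbourhoods $N(x)$, $x$ is maximally distant from $y$ if $d(y,w)\le d(x,y)$ for all $w\in N(x)$, and $x,y$ are mutually maximally distant (MMD) if each is maximally distant from the other. The strong resolving graph $\Gamma_{SR}$ has as vertex set the set of vertices that are MMD with some vertex, two vertices being adjacent iff they are MMD in $\Gamma$. $G$ is the graph with vertex set $\{(e,u): 0\neq e\in\mathrm{Id}(R), u\in U(R)\}$ in which distinct $(e,u),(f,v)$ are adjacent iff $ef\neq 0$ and $uv\neq 1$. *)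

theory Defs
  imports
    "HOL-Algebra.Ring"
    "HOL-Library.Equipollence"
    "Graph_Theory.Digraph_Component"
    "Graph_Theory.Shortest_Path"
begin

text \<open>
  Simple graphs, possibly infinite, are symmetric loop-free pair digraphs
  (\<^locale>\<open>pair_bidirected_digraph\<close>). The locale \<^locale>\<open>pair_graph\<close> and the complete
  graphs of the library are restricted to finite vertex sets.
\<close>

definition complete_graph :: "'v pair_pre_digraph \<Rightarrow> bool" where
  "complete_graph K \<longleftrightarrow> parcs K = {(x, y). x \<in> pverts K \<and> y \<in> pverts K \<and> x \<noteq> y}"

definition gdist :: "'v pair_pre_digraph \<Rightarrow> 'v \<Rightarrow> 'v \<Rightarrow> ereal" where
  "gdist \<Gamma> = wf_digraph.\<mu> (with_proj \<Gamma>) (\<lambda>_. 1)"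

definition neighbourhood :: "'v pair_pre_digraph \<Rightarrow> 'v \<Rightarrow> 'v set" where
  "neighbourhood \<Gamma> x = {w. (x, w) \<in> parcs \<Gamma>}"

definition maximally_distant :: "'v pair_pre_digraph \<Rightarrow> 'v \<Rightarrow> 'v \<Rightarrow> bool" where
  "maximally_distant \<Gamma> x y \<longleftrightarrow> (\<forall>w \<in> neighbourhood \<Gamma> x. gdist \<Gamma> y w \<le> gdist \<Gamma> x y)"

definition mmd :: "'v pair_pre_digraph \<Rightarrow> 'v \<Rightarrow> 'v \<Rightarrow> bool" where
  "mmd \<Gamma> x y \<longleftrightarrow> maximally_distant \<Gamma> x y \<and> maximally_distant \<Gamma> y x"

definition strong_resolving_graph :: "'v pair_pre_digraph \<Rightarrow> 'v pair_pre_digraph" where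
  "strong_resolving_graph \<Gamma> =
    \<lparr> pverts = {x \<in> pverts \<Gamma>. \<exists>y \<in> pverts \<Gamma>. mmd \<Gamma> x y},
      parcs = {(x, y). x \<in> pverts \<Gamma> \<and> y \<in> pverts \<Gamma> \<and> x \<noteq> y \<and> mmd \<Gamma> x y} \<rparr>"

definition idempotents :: "('a, 'b) ring_scheme \<Rightarrow> 'a set" where
  "idempotents R = {e \<in> carrier R. e \<otimes>\<^bsub>R\<^esub> e = e}"

definition clean_graph :: "('a, 'b) ring_scheme \<Rightarrow> ('a \<times> 'a) pair_pre_digraph" where
  "clean_graph R =
    \<lparr> pverts = idempotents R \<times> Units R,
      parcs = {((e, u), (f, v)).
        (e, u) \<in> idempotents R \<times> Units R \<and> (f, v) \<in> idempotents R \<times> Units R \<and>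
        (e, u) \<noteq> (f, v) \<and> (e \<otimes>\<^bsub>R\<^esub> f = \<zero>\<^bsub>R\<^esub> \<or> u \<otimes>\<^bsub>R\<^esub> v = \<one>\<^bsub>R\<^esub>)} \<rparr>"

definition graph_G :: "('a, 'b) ring_scheme \<Rightarrow> ('a \<times> 'a) pair_pre_digraph" where
  "graph_G R =
    \<lparr> pverts = (idempotents R - {\<zero>\<^bsub>R\<^esub>}) \<times> Units R,
      parcs = {((e, u), (f, v)).
        (e, u) \<in> (idempotents R - {\<zero>\<^bsub>R\<^esub>}) \<times> Units R \<and>
        (f, v) \<in> (idempotents R - {\<zero>\<^bsub>R\<^esub>}) \<times> Units R \<and>
        (e, u) \<noteq> (f, v) \<and> e \<otimes>\<^bsub>R\<^esub> f \<noteq> \<zero>\<^bsub>R\<^esub> \<and> u \<otimes>\<^bsub>R\<^esub> v \<noteq> \<one>\<^bsub>R\<^esub>} \<rparr>"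

lemma pair_bidirected_digraph_clean_graph:
  assumes "cring R"
  shows "pair_bidirected_digraph (clean_graph R)"
proof -
  interpret cring R by fact
  have "symmetric (with_proj (clean_graph R))"
    by (auto simp: symmetric_def arcs_ends_def arc_to_ends_def with_proj_def
        clean_graph_def idempotents_def sym_def image_iff m_comm Units_closed)
  then show ?thesis
    by unfold_locales (auto simp: clean_graph_def)
qed

lemma pair_bidirected_digraph_graph_G:
  assumes "cring R"
  shows "pair_bidirected_digraph (graph_G R)"
proof -
  interpret cring R by fact
  have "symmetric (with_proj (graph_G R))"
    by (auto simp: symmetric_def arcs_ends_def arc_to_ends_def with_proj_def
        graph_G_def idempotents_def sym_def image_iff m_comm Units_closed)
  then show ?thesis
    by unfold_locales (auto simp: graph_G_def)
qed

lemma pair_bidirected_digraph_strong_resolving_graph: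
  "pair_bidirected_digraph (strong_resolving_graph \<Gamma>)"
proof -
  have "symmetric (with_proj (strong_resolving_graph \<Gamma>))"
    by (auto simp: symmetric_def arcs_ends_def arc_to_ends_def with_proj_def
        strong_resolving_graph_def mmd_def sym_def image_iff)
  then show ?thesis
    by unfold_locales (auto simp: strong_resolving_graph_def mmd_def)
qed

end

theory Submission
  imports Defs
begin

text \<open>
  Every vertex \<open>(0, u)\<close> is adjacent to all others, so distances in the clean graph are at most 2:
  distinct non-adjacent vertices are always mutually maximally distant, and adjacent ones are so
  exactly when they are true twins, i.e. have the same closed neighbourhood. As the clean graph is
  not complete, there is a unit other than 1, hence for every unit \<open>v\<close> there is a unit
  outside \<open>{v, v\<inverse>}\<close>. Together with a nontrivial idempotent, such units
  yield for any two adjacent vertices, not both with first component 0, a vertex adjacent to exactly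
  one of them. The same units make every vertex of \<open>G\<close> adjacent to some \<open>(1, w)\<close>,
  and link the vertices \<open>(1, w)\<close> among each other.
\<close>

section \<open>Mutually maximally distant vertices\<close>

context pair_wf_digraph
begin

lemma gdist_refl:
  assumes "x \<in> pverts G"
  shows "gdist G x x = 0"
proof -
  have "gdist G x x \<le> 0"
    using min_cost_le_walk_cost[of x "[]" x "\<lambda>_. 1"] assms
    by (simp add: gdist_def awalk_Nil_iff zero_ereal_def)
  moreover have "0 \<le> gdist G x x"
    unfolding gdist_def \<mu>_def
    by (rule INF_greatest) (auto intro: pos_cost_pos_awalk_cost)
  ultimately show ?thesis by simp
qed

lemma gdist_arc_le:
  assumes "(x, y) \<in> parcs G"
  shows "gdist G x y \<le> 1"
proof -
  have "awalk x [(x, y)] y"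
    using assms in_arcsD2[OF assms] by (simp add: awalk_simps)
  from min_cost_le_walk_cost[OF this, of "\<lambda>_. 1"] show ?thesis
    by (simp add: gdist_def one_ereal_def)
qed

lemma gdist_two_arcs_le:
  assumes "(x, z) \<in> parcs G" "(z, y) \<in> parcs G"
  shows "gdist G x y \<le> 2"
proof -
  have "awalk x [(x, z), (z, y)] y"
    using assms in_arcsD2[OF assms(2)] by (simp add: awalk_simps)
  from min_cost_le_walk_cost[OF this, of "\<lambda>_. 1"] show ?thesis
    by (simp add: gdist_def)
qed

lemma gdist_ge_1:
  assumes "x \<noteq> y"
  shows "1 \<le> gdist G x y"
  unfolding gdist_def \<mu>_def
proof (rule INF_greatest)
  fix p assume "p \<in> {p. awalk x p y}"
  then show "1 \<le> ereal (awalk_cost (\<lambda>_. 1) p)"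
    using assms pos_cost_pos_awalk_cost[of _ _ _ "\<lambda>_. 1"]
    by (cases p) (force simp: awalk_simps)+
qed

lemma gdist_ge_2:
  assumes "x \<noteq> y" "(x, y) \<notin> parcs G"
  shows "2 \<le> gdist G x y"
  unfolding gdist_def \<mu>_def
proof (rule INF_greatest)
  fix p assume p: "p \<in> {p. awalk x p y}"
  \<comment> \<open>The empty walk would force \<open>x = y\<close>, and a one-arc walk would be the
    excluded arc from \<open>x\<close> to \<open>y\<close>.\<close>
  with assms obtain a b q where "p = a # b # q"
    by (cases p; cases "tl p") (auto simp: awalk_simps)
  moreover from this p have "0 \<le> awalk_cost (\<lambda>_. 1) q"
    using pos_cost_pos_awalk_cost[of _ q y "\<lambda>_. 1"] by (auto simp: awalk_simps)
  ultimately show "2 \<le> ereal (awalk_cost (\<lambda>_. 1) p)" by simp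
qed

lemma gdist_arc:
  assumes "(x, y) \<in> parcs G" "x \<noteq> y"
  shows "gdist G x y = 1"
  using gdist_arc_le[OF assms(1)] gdist_ge_1[OF assms(2)] by (rule antisym)

text \<open>With unit costs no distance lies strictly between 1 and 2. This turns the distance
  bounds in \<open>maximally_distant\<close> into adjacency conditions.\<close>

lemma gdist_le_1_iff:
  assumes "x \<in> pverts G"
  shows "gdist G x y \<le> 1 \<longleftrightarrow> x = y \<or> (x, y) \<in> parcs G"
proof
  assume le: "gdist G x y \<le> 1"
  have "\<not> (2::ereal) \<le> 1" by simp
  then show "x = y \<or> (x, y) \<in> parcs G"
    using gdist_ge_2[of x y] le order_trans by blast
qed (use assms gdist_refl gdist_arc_le in auto)

end

context pair_bidirected_digraph
begin

text \<open>The ends of an arc are at distance 1, so each neighbour of one end must be within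
  distance 1 of the other end. This is the true-twin condition.\<close>

lemma mmd_arc_iff:
  assumes "(x, y) \<in> parcs G"
  shows "mmd G x y \<longleftrightarrow>
    (\<forall>w. (x, w) \<in> parcs G \<longrightarrow> w = y \<or> (y, w) \<in> parcs G) \<and>
    (\<forall>w. (y, w) \<in> parcs G \<longrightarrow> w = x \<or> (x, w) \<in> parcs G)"
proof -
  have "(y, x) \<in> parcs G" "x \<noteq> y" "x \<in> pverts G" "y \<in> pverts G"
    using assms arcs_symmetric no_loops' in_arcsD1 in_arcsD2 by blast+
  then show ?thesis
    using assms
    by (auto simp: mmd_def maximally_distant_def neighbourhood_def gdist_arc gdist_le_1_iff)
qed

text \<open>The dominating vertex \<open>c\<close> bounds all distances by 2, and distinct
  non-adjacent vertices already attain this bound.\<close>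

lemma mmd_if_not_arc:
  assumes dominating: "\<And>z. z \<in> pverts G \<Longrightarrow> z \<noteq> c \<Longrightarrow> (c, z) \<in> parcs G"
    and "x \<in> pverts G" "y \<in> pverts G" "x \<noteq> y" "(x, y) \<notin> parcs G"
  shows "mmd G x y"
proof -
  have le: "gdist G a b \<le> 2" if ab: "a \<in> pverts G" "b \<in> pverts G" for a b
  proof -
    \<comment> \<open>If exactly one of \<open>a\<close>, \<open>b\<close> is \<open>c\<close>, they
      are adjacent; if neither is, there is a walk through \<open>c\<close>.\<close>
    consider "a = b" | "(a, b) \<in> parcs G" | "(a, c) \<in> parcs G" "(c, b) \<in> parcs G"
      using dominating[OF ab(1)] dominating[OF ab(2)] arcs_symmetric by blast
    then show ?thesis
    proof cases
      case 1 then show ?thesis using gdist_refl[OF ab(1)] by simp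
    next
      case 2
      have "(1::ereal) \<le> 2" by simp
      with gdist_arc_le[OF 2] show ?thesis by (rule order_trans)
    next
      case 3 then show ?thesis by (rule gdist_two_arcs_le)
    qed
  qed
  have "(y, x) \<notin> parcs G" using assms arcs_symmetric by blast
  then have "2 \<le> gdist G x y" "2 \<le> gdist G y x" using gdist_ge_2 assms by auto
  then show ?thesis
    unfolding mmd_def maximally_distant_def neighbourhood_def
    using le assms(2,3) in_arcsD2 by (blast intro: order_trans)
qed

end

section \<open>The clean graph\<close>

context cring
begin

lemma clean_graph_verts_iff:
  "(e, u) \<in> pverts (clean_graph R) \<longleftrightarrow> e \<in> idempotents R \<and> u \<in> Units R"
  by (simp add: clean_graph_def)

lemma clean_graph_arc_iff:
  "((e, u), (f, v)) \<in> parcs (clean_graph R) \<longleftrightarrow>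
    e \<in> idempotents R \<and> u \<in> Units R \<and> f \<in> idempotents R \<and> v \<in> Units R \<and>
    (e, u) \<noteq> (f, v) \<and> (e \<otimes> f = \<zero> \<or> u \<otimes> v = \<one>)"
  by (auto simp: clean_graph_def)

lemma graph_G_arc_iff:
  "((e, u), (f, v)) \<in> parcs (graph_G R) \<longleftrightarrow>
    e \<in> idempotents R \<and> e \<noteq> \<zero> \<and> u \<in> Units R \<and>
    f \<in> idempotents R \<and> f \<noteq> \<zero> \<and> v \<in> Units R \<and>
    (e, u) \<noteq> (f, v) \<and> e \<otimes> f \<noteq> \<zero> \<and> u \<otimes> v \<noteq> \<one>"
  by (auto simp: graph_G_def)

section \<open>Idempotents and units\<close>

lemma idempotents_closed: "e \<in> idempotents R \<Longrightarrow> e \<in> carrier R"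
  by (simp add: idempotents_def)

lemma idempotents_square: "e \<in> idempotents R \<Longrightarrow> e \<otimes> e = e"
  by (simp add: idempotents_def)

lemma zero_idempotent: "\<zero> \<in> idempotents R"
  by (simp add: idempotents_def)

lemma one_idempotent: "\<one> \<in> idempotents R"
  by (simp add: idempotents_def)

lemma mult_complement:
  assumes "e \<in> idempotents R"
  shows "e \<otimes> (\<one> \<ominus> e) = \<zero>"
  using assms by (simp add: idempotents_def minus_eq r_distr r_minus r_neg)

lemma complement_idempotent:
  assumes "e \<in> idempotents R"
  shows "\<one> \<ominus> e \<in> idempotents R"
proof -
  have e: "e \<in> carrier R" using assms by (rule idempotents_closed)
  have "(\<one> \<ominus> e) \<otimes> (\<one> \<ominus> e) = (\<one> \<ominus> e) \<ominus> e \<otimes> (\<one> \<ominus> e)"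
    using e by (simp add: minus_eq l_distr l_minus)
  also have "\<dots> = \<one> \<ominus> e"
    unfolding mult_complement[OF assms] using e by (simp add: minus_eq)
  finally show ?thesis using e by (simp add: idempotents_def)
qed

text \<open>\<open>a \<otimes> (\<one> \<ominus> b) = \<zero>\<close> means
  \<open>a = a \<otimes> b\<close>, so \<open>e = e \<otimes> f = f\<close>. Contrapositively, the
  complement of one of two different idempotents does not annihilate the other.\<close>

lemma idempotents_eq_if_mult_complement_zero:
  assumes "e \<in> idempotents R" "f \<in> idempotents R"
    and "e \<otimes> (\<one> \<ominus> f) = \<zero>" "f \<otimes> (\<one> \<ominus> e) = \<zero>"
  shows "e = f"
proof -
  have *: "a = a \<otimes> b" if "a \<in> carrier R" "b \<in> carrier R" "a \<otimes> (\<one> \<ominus> b) = \<zero>" for a b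
  proof -
    have "b \<oplus> (\<one> \<ominus> b) = \<one>"
      using that by (simp add: minus_eq a_lcomm[of b] r_neg)
    moreover have "a \<otimes> (b \<oplus> (\<one> \<ominus> b)) = a \<otimes> b \<oplus> a \<otimes> (\<one> \<ominus> b)"
      using that by (intro r_distr) auto
    ultimately show ?thesis using that by simp
  qed
  show ?thesis
    using *[of e f] *[of f e] assms m_comm idempotents_closed by metis
qed

lemma Units_mult_eq_one_iff:
  assumes "u \<in> Units R" "v \<in> Units R"
  shows "u \<otimes> v = \<one> \<longleftrightarrow> v = inv u"
  using assms by (metis Units_closed Units_r_inv comm_inv_char)

text \<open>For \<open>v = \<one>\<close> the pair of \<open>v\<close> and its inverse is just
  \<open>\<one>\<close>, which \<open>t\<close> avoids; otherwise \<open>\<one>\<close> itself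
  avoids the pair.\<close>

lemma ex_unit_avoiding_inverse_pair:
  assumes "t \<in> Units R" "t \<noteq> \<one>" and v: "v \<in> Units R"
  obtains w where "w \<in> Units R" "w \<noteq> v" "v \<otimes> w \<noteq> \<one>"
proof (cases "v = \<one>")
  case True
  with assms show ?thesis by (intro that[of t]) auto
next
  case False
  with v show ?thesis by (intro that[of \<one>]) auto
qed

lemma clean_graph_dominating:
  assumes "z \<in> pverts (clean_graph R)" "z \<noteq> (\<zero>, u)" "u \<in> Units R"
  shows "((\<zero>, u), z) \<in> parcs (clean_graph R)"
  using assms zero_idempotent idempotents_closed
  by (cases z) (auto simp: clean_graph_verts_iff clean_graph_arc_iff)

text \<open>If \<open>\<one>\<close> were the only unit, any two vertices would satisfy
  \<open>u \<otimes> v = \<one>\<close> and the clean graph would be complete.\<close>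

lemma ex_nontrivial_unit:
  assumes "\<not> complete_graph (clean_graph R)"
  obtains t where "t \<in> Units R" "t \<noteq> \<one>"
proof -
  have "\<exists>t \<in> Units R. t \<noteq> \<one>"
    using assms by (force simp: complete_graph_def clean_graph_def)
  then show ?thesis using that by blast
qed

section \<open>Mutually maximally distant pairs in the clean graph\<close>

context
  fixes d t
  assumes d: "d \<in> idempotents R" "d \<noteq> \<zero>" "d \<noteq> \<one>"
    and t: "t \<in> Units R" "t \<noteq> \<one>"
begin

lemma one_neq_zero: "\<one> \<noteq> \<zero>"
  using d(1,2) idempotents_closed by (metis r_null r_one)

text \<open>Serves to leave \<open>(f, v)\<close> by changing only the idempotent, without creating
  an adjacency through a zero product.\<close>

lemma ex_other_idempotent_mult_nonzero:
  assumes "f \<in> idempotents R" "f \<noteq> \<zero>"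
  obtains g where "g \<in> idempotents R" "g \<noteq> f" "f \<otimes> g \<noteq> \<zero>"
proof (cases "f = \<one>")
  case True
  with d idempotents_closed show ?thesis by (intro that[of d]) auto
next
  case False
  with assms one_idempotent idempotents_closed show ?thesis by (intro that[of \<one>]) auto
qed

text \<open>Each case exhibits a neighbour of one end that is neither the other end nor adjacent to
  it. By symmetry of \<open>mmd\<close>, reversing the arc covers
  \<open>e \<noteq> \<zero>\<close>.\<close>

lemma clean_graph_not_twins:
  assumes arc: "((e, u), (f, v)) \<in> parcs (clean_graph R)" and "f \<noteq> \<zero>"
  shows "\<not> mmd (clean_graph R) (e, u) (f, v)"
proof -
  interpret C: pair_bidirected_digraph "clean_graph R"
    by (rule pair_bidirected_digraph_clean_graph) (rule is_cring)
  have e: "e \<in> idempotents R" "e \<in> carrier R" and f: "f \<in> idempotents R" "f \<in> carrier R"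
    and u: "u \<in> Units R" and v: "v \<in> Units R"
    using arc idempotents_closed by (auto simp: clean_graph_arc_iff)
  have separated: ?thesis
    if "((e, u), (g, w)) \<in> parcs (clean_graph R)" "(g, w) \<noteq> (f, v)"
      "f \<otimes> g \<noteq> \<zero>" "v \<otimes> w \<noteq> \<one>" for g w
  proof -
    have "((f, v), (g, w)) \<notin> parcs (clean_graph R)"
      using that by (simp add: clean_graph_arc_iff)
    with that show ?thesis unfolding C.mmd_arc_iff[OF arc] by blast
  qed
  have separated': ?thesis
    if "((f, v), (g, w)) \<in> parcs (clean_graph R)" "(g, w) \<noteq> (e, u)"
      "e \<otimes> g \<noteq> \<zero>" "u \<otimes> w \<noteq> \<one>" for g w
  proof -
    have "((e, u), (g, w)) \<notin> parcs (clean_graph R)"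
      using that by (simp add: clean_graph_arc_iff)
    with that show ?thesis unfolding C.mmd_arc_iff[OF arc] by blast
  qed
  obtain w where w: "w \<in> Units R" "w \<noteq> v" "v \<otimes> w \<noteq> \<one>"
    using ex_unit_avoiding_inverse_pair[OF t v] .
  consider "e \<otimes> f = \<zero>" | "u \<otimes> v = \<one>" "u \<noteq> v" | "u \<otimes> v = \<one>" "u = v"
    using arc by (auto simp: clean_graph_arc_iff)
  then show ?thesis
  proof cases
    \<comment> \<open>\<open>(f, w)\<close> is adjacent to \<open>(e, u)\<close> by
      \<open>e \<otimes> f = \<zero>\<close>, but not to \<open>(f, v)\<close>, since
      \<open>f \<otimes> f = f\<close> is nonzero. \<open>e \<noteq> f\<close> keeps it apart from
      \<open>(e, u)\<close>.\<close>
    case 1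
    then have "e \<noteq> f"
      using f \<open>f \<noteq> \<zero>\<close> by (auto simp: idempotents_square)
    with 1 e f u w \<open>f \<noteq> \<zero>\<close> show ?thesis
      by (intro separated[of f w]) (auto simp: clean_graph_arc_iff idempotents_square)
  next
    \<comment> \<open>Here \<open>v\<close> is not self-inverse, so \<open>(g, v)\<close> is
      adjacent to \<open>(e, u)\<close> through the units but not to \<open>(f, v)\<close>.\<close>
    case 2
    obtain g where "g \<in> idempotents R" "g \<noteq> f" "f \<otimes> g \<noteq> \<zero>"
      using ex_other_idempotent_mult_nonzero[OF f(1) \<open>f \<noteq> \<zero>\<close>] .
    moreover have "v \<otimes> v \<noteq> \<one>"
      using 2 u v by (metis Units_closed Units_mult_eq_one_iff m_comm)
    ultimately show ?thesis
      using 2 e u v by (intro separated[of g v]) (auto simp: clean_graph_arc_iff)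
  next
    \<comment> \<open>The units agree, so the idempotents differ and a complement tells them apart:
      \<open>\<one> \<ominus> e\<close> annihilates \<open>e\<close> but not \<open>f\<close>, or
      the other way round. The unit \<open>w\<close> rules out adjacency through the units.\<close>
    case 3
    then have "e \<noteq> f" using arc by (auto simp: clean_graph_arc_iff)
    then have "f \<otimes> (\<one> \<ominus> e) \<noteq> \<zero> \<or> e \<otimes> (\<one> \<ominus> f) \<noteq> \<zero>"
      using idempotents_eq_if_mult_complement_zero e f by blast
    then show ?thesis
      using 3 e f u v w separated[of "\<one> \<ominus> e" w] separated'[of "\<one> \<ominus> f" w]
      by (auto simp: clean_graph_arc_iff complement_idempotent mult_complement)
  qed
qed

lemma mmd_clean_graph_iff:
  assumes "(e, u) \<in> pverts (clean_graph R)" "(f, v) \<in> pverts (clean_graph R)" "(e, u) \<noteq> (f, v)"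
  shows "mmd (clean_graph R) (e, u) (f, v) \<longleftrightarrow>
    (e = \<zero> \<and> f = \<zero>) \<or> ((e, u), (f, v)) \<in> parcs (graph_G R)"
proof -
  interpret C: pair_bidirected_digraph "clean_graph R"
    by (rule pair_bidirected_digraph_clean_graph) (rule is_cring)
  have carrier: "e \<in> carrier R" "f \<in> carrier R"
    using assms idempotents_closed by (auto simp: clean_graph_verts_iff)
  show ?thesis
  proof (cases "((e, u), (f, v)) \<in> parcs (clean_graph R)")
    case arc: True
    then have not_G: "((e, u), (f, v)) \<notin> parcs (graph_G R)"
      by (auto simp: clean_graph_arc_iff graph_G_arc_iff)
    have arc': "((f, v), (e, u)) \<in> parcs (clean_graph R)"
      using arc C.arcs_symmetric by blast
    show ?thesis
    proof (cases "e = \<zero> \<and> f = \<zero>")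
      case True
      \<comment> \<open>Both vertices are dominating, hence twins.\<close>
      then show ?thesis
        unfolding C.mmd_arc_iff[OF arc] using assms clean_graph_dominating
        by (metis C.in_arcsD2 clean_graph_verts_iff)
    next
      case False
      then show ?thesis
        using clean_graph_not_twins[OF arc] clean_graph_not_twins[OF arc'] not_G
        by (auto simp: mmd_def)
    qed
  next
    case False
    \<comment> \<open>Non-adjacency gives \<open>e \<otimes> f \<noteq> \<zero>\<close>, which
      already forces both idempotents to be nonzero.\<close>
    with assms carrier have "((e, u), (f, v)) \<in> parcs (graph_G R)"
      by (auto simp: clean_graph_arc_iff graph_G_arc_iff clean_graph_verts_iff)
    moreover have "mmd (clean_graph R) (e, u) (f, v)"
      using assms False clean_graph_dominating by (intro C.mmd_if_not_arc[of "(\<zero>, \<one>)"]) auto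
    ultimately show ?thesis by blast
  qed
qed

section \<open>The strong resolving graph of the clean graph\<close>

lemma pverts_strong_resolving_clean_graph:
  "pverts (strong_resolving_graph (clean_graph R)) = pverts (clean_graph R)"
proof -
  have "\<exists>y \<in> pverts (clean_graph R). mmd (clean_graph R) (e, u) y"
    if eu: "(e, u) \<in> pverts (clean_graph R)" for e u
  proof -
    have e: "e \<in> idempotents R" and u: "u \<in> Units R"
      using eu by (auto simp: clean_graph_verts_iff)
    obtain w where w: "w \<in> Units R" "w \<noteq> u" "u \<otimes> w \<noteq> \<one>"
      using ex_unit_avoiding_inverse_pair[OF t u] .
    then have "(e, w) \<in> pverts (clean_graph R)"
      using e by (simp add: clean_graph_verts_iff)
    \<comment> \<open>For \<open>e = \<zero>\<close> both vertices are dominating; otherwise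
      \<open>e \<otimes> e = e\<close> is nonzero and the pair is an arc of
      \<open>graph_G R\<close>.\<close>
    moreover from this have "mmd (clean_graph R) (e, u) (e, w)"
      using eu w e u by (auto simp: mmd_clean_graph_iff graph_G_arc_iff idempotents_square)
    ultimately show ?thesis by blast
  qed
  then show ?thesis by (auto simp: strong_resolving_graph_def)
qed

lemma strong_resolving_clean_graph_eq:
  assumes K: "K = \<lparr>pverts = {\<zero>} \<times> Units R,
    parcs = {(x, y). x \<in> {\<zero>} \<times> Units R \<and> y \<in> {\<zero>} \<times> Units R \<and> x \<noteq> y}\<rparr>"
  shows "with_proj (strong_resolving_graph (clean_graph R))
    = union (with_proj (graph_G R)) (with_proj K)"
proof -
  have "pverts (strong_resolving_graph (clean_graph R)) = pverts (graph_G R) \<union> pverts K"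
    unfolding pverts_strong_resolving_clean_graph
    using zero_idempotent by (auto simp: K graph_G_def clean_graph_def)
  moreover have "parcs (strong_resolving_graph (clean_graph R)) = parcs (graph_G R) \<union> parcs K"
  proof -
    have "(x, y) \<in> parcs (strong_resolving_graph (clean_graph R)) \<longleftrightarrow>
      (x, y) \<in> parcs (graph_G R) \<union> parcs K" for x y
      using mmd_clean_graph_iff[of "fst x" "snd x" "fst y" "snd y"] zero_idempotent
      by (cases x; cases y)
        (auto simp: strong_resolving_graph_def K clean_graph_verts_iff graph_G_arc_iff)
    then show ?thesis by auto
  qed
  ultimately show ?thesis by (simp add: with_proj_def union_def)
qed

section \<open>Connectedness of \<open>graph_G R\<close>\<close>

lemma connected_graph_G: "connected (with_proj (graph_G R))"
proof -
  interpret G: pair_bidirected_digraph "graph_G R"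
    by (rule pair_bidirected_digraph_graph_G) (rule is_cring)
  have arc_reachable: "x \<rightarrow>\<^sup>*\<^bsub>with_proj (graph_G R)\<^esub> y" if "(x, y) \<in> parcs (graph_G R)" for x y
    using that by (intro G.reachable_adjI) simp
  \<comment> \<open>As \<open>e \<otimes> \<one> = e\<close> is nonzero, only the condition on the
    units has to be arranged.\<close>
  have to_one: "((e, u), (\<one>, w)) \<in> parcs (graph_G R)"
    if "e \<in> idempotents R" "e \<noteq> \<zero>" "u \<in> Units R" "w \<in> Units R" "w \<noteq> u" "u \<otimes> w \<noteq> \<one>" for e u w
    using that one_idempotent one_neq_zero idempotents_closed by (auto simp: graph_G_arc_iff)
  have ones: "(\<one>, u) \<rightarrow>\<^sup>*\<^bsub>with_proj (graph_G R)\<^esub> (\<one>, v)" if u: "u \<in> Units R" and v: "v \<in> Units R" for u v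
  proof -
    obtain w where w: "w \<in> Units R" "w \<noteq> u" "u \<otimes> w \<noteq> \<one>"
      using ex_unit_avoiding_inverse_pair[OF t u] .
    consider "u = v" | "u \<noteq> v" "u \<otimes> v \<noteq> \<one>" | "u \<noteq> v" "u \<otimes> v = \<one>" by blast
    then show ?thesis
    proof cases
      case 1
      have "(\<one>, u) \<in> pverts (graph_G R)"
        using u one_idempotent one_neq_zero by (simp add: graph_G_def)
      with 1 show ?thesis by simp
    next
      case 2
      then show ?thesis using u v one_idempotent one_neq_zero to_one arc_reachable by metis
    next
      case 3
      \<comment> \<open>\<open>u\<close> and \<open>v\<close> are inverse to each other, so a unit
        avoiding \<open>u\<close> and its inverse also avoids \<open>v\<close> and its
        inverse.\<close>
      then have "w \<noteq> v" "w \<otimes> v \<noteq> \<one>"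
        using w u v by (metis Units_closed Units_mult_eq_one_iff m_comm)+
      then have "((\<one>, u), (\<one>, w)) \<in> parcs (graph_G R)" "((\<one>, w), (\<one>, v)) \<in> parcs (graph_G R)"
        using to_one u v w one_idempotent one_neq_zero by metis+
      then show ?thesis using arc_reachable G.reachable_trans by blast
    qed
  qed
  have to_ones: "\<exists>w \<in> Units R. ((e, u), (\<one>, w)) \<in> parcs (graph_G R)"
    if "(e, u) \<in> pverts (graph_G R)" for e u
  proof -
    have "e \<in> idempotents R" "e \<noteq> \<zero>" "u \<in> Units R"
      using that by (auto simp: graph_G_def)
    moreover obtain w where "w \<in> Units R" "w \<noteq> u" "u \<otimes> w \<noteq> \<one>"
      using ex_unit_avoiding_inverse_pair[OF t \<open>u \<in> Units R\<close>] .
    ultimately show ?thesis using to_one by blast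
  qed
  have "x \<rightarrow>\<^sup>*\<^bsub>with_proj (graph_G R)\<^esub> y"
    if x: "x \<in> pverts (graph_G R)" and y: "y \<in> pverts (graph_G R)" for x y
  proof -
    obtain w where w: "w \<in> Units R" "(x, (\<one>, w)) \<in> parcs (graph_G R)"
      using to_ones x by (metis surj_pair)
    obtain w' where w': "w' \<in> Units R" "(y, (\<one>, w')) \<in> parcs (graph_G R)"
      using to_ones y by (metis surj_pair)
    have "((\<one>, w'), y) \<in> parcs (graph_G R)"
      using w'(2) G.arcs_symmetric by blast
    then show ?thesis
      using arc_reachable ones w w' G.reachable_trans by meson
  qed
  \<comment> \<open>Connectedness includes that there is at least one vertex.\<close>
  moreover have "(\<one>, \<one>) \<in> pverts (graph_G R)"
    using one_idempotent one_neq_zero by (simp add: graph_G_def)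
  ultimately show ?thesis
    by (intro G.connectedI G.reachable_mk_symmetricI) auto
qed

end

end

theorem theorem3p6:
  fixes R :: "('a, 'b) ring_scheme"
  assumes "cring R"
    and "\<exists>e \<in> idempotents R. e \<noteq> \<zero>\<^bsub>R\<^esub> \<and> e \<noteq> \<one>\<^bsub>R\<^esub>"
    and "\<not> complete_graph (clean_graph R)"
  shows "(\<exists>K. complete_graph K \<and> pverts K \<approx> Units R \<and>
            pverts (graph_G R) \<inter> pverts K = {} \<and>
            with_proj (strong_resolving_graph (clean_graph R))
              = union (with_proj (graph_G R)) (with_proj K))
    \<and> connected (with_proj (graph_G R))
    \<and> pverts (clean_graph R) = pverts (strong_resolving_graph (clean_graph R))"
proof -
  interpret cring R by fact
  obtain d where d: "d \<in> idempotents R" "d \<noteq> \<zero>\<^bsub>R\<^esub>" "d \<noteq> \<one>\<^bsub>R\<^esub>"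
    using assms(2) by blast
  obtain t where t: "t \<in> Units R" "t \<noteq> \<one>\<^bsub>R\<^esub>"
    using ex_nontrivial_unit[OF assms(3)] .
  \<comment> \<open>Placing \<open>K\<close> on the clean graph's own vertices with first component
    zero makes the decomposition an equality of graphs, not merely an isomorphism.\<close>
  define K where "K = \<lparr>pverts = {\<zero>\<^bsub>R\<^esub>} \<times> Units R,
    parcs = {(x, y). x \<in> {\<zero>\<^bsub>R\<^esub>} \<times> Units R \<and> y \<in> {\<zero>\<^bsub>R\<^esub>} \<times> Units R \<and> x \<noteq> y}\<rparr>"
  have "complete_graph K"
    by (simp add: K_def complete_graph_def)
  moreover have "pverts K \<approx> Units R"
    unfolding eqpoll_def by (rule exI[of _ snd]) (auto simp: K_def bij_betw_def inj_on_def image_iff)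
  moreover have "pverts (graph_G R) \<inter> pverts K = {}"
    by (auto simp: K_def graph_G_def)
  ultimately show ?thesis
    using strong_resolving_clean_graph_eq[OF d t K_def] connected_graph_G[OF d t]
      pverts_strong_resolving_clean_graph[OF d t] by blast
qed

end
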